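(* Let $A \supseteq B$ be a Frobenius extension of algebras over a field, having a Frobenius homomorphism $E : A \to B$ that satisfies $E(1) = 1$. Then $A$ is a uniquely split extension of $B$ if and only if the centralizer of $B$ in $A$ equals the center of $B$, i.e. $A^B = Z(B)$.
   Context: Algebras are unital and associative; $B$ is a subalgebra of $A$ with $1_B = 1_A$. $A^B = \{a \in A : ab = ba \text{ for all } b \in B\}$ is the centralizer and $Z(B)$ is the center of $B$. $A \supseteq B$ is a Frobenius extension if there is a $B$-$B$-bimodule homomorphism $E : A \to B$ (a Frobenius homomorphism) and elements (dual bases) $x_1,\dots,x_n,y_1,\dots,y_n \in A$ such that $a = \sum_{i} E(a x_i) y_i = \sum_{i} x_i E(y_i a)$ for all $a \in A$. $A$ is a uniquely split extension of $B$ if there is exactly one bimodule projection from $A$ to $B$, i.e. exactly one $B$-$B$-bimodule homomorphism $F : A \to B$ with $F(1_A) = 1_B$. *)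

theory Defs
  imports Complex_Main
begin

(* The sort {ring, monoid_mult} is a unital associative ring; unlike ring_1 it does not
   demand 0 \<noteq> 1, so the zero algebra is allowed. *)
locale unital_algebra = vector_space scale
  for scale :: "'k::field \<Rightarrow> 'a::{ring, monoid_mult} \<Rightarrow> 'a" +
  assumes scale_mult_left: "scale c x * y = scale c (x * y)"
    and scale_mult_right: "x * scale c y = scale c (x * y)"

definition subalgebra :: "('k::field \<Rightarrow> 'a::{ring, monoid_mult} \<Rightarrow> 'a) \<Rightarrow> 'a set \<Rightarrow> bool" where
  "subalgebra scale B \<longleftrightarrow>
     module.subspace scale B \<and> 1 \<in> B \<and> (\<forall>x\<in>B. \<forall>y\<in>B. x * y \<in> B)"

definition centralizer :: "'a::{ring, monoid_mult} set \<Rightarrow> 'a set" where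
  "centralizer B = {a. \<forall>b\<in>B. a * b = b * a}"

definition center :: "'a::{ring, monoid_mult} set \<Rightarrow> 'a set" where
  "center B = {z \<in> B. \<forall>b\<in>B. z * b = b * z}"

(* The homomorphisms from the whole algebra A = UNIV to the subalgebra B. Linearity over the
   base field is the case b = c 1 of left B-linearity, since 1 is in B. *)
definition bimodule_hom :: "'a::{ring, monoid_mult} set \<Rightarrow> ('a \<Rightarrow> 'a) \<Rightarrow> bool" where
  "bimodule_hom B F \<longleftrightarrow>
     range F \<subseteq> B \<and> additive F \<and>
     (\<forall>b\<in>B. \<forall>a. F (b * a) = b * F a) \<and> (\<forall>b\<in>B. \<forall>a. F (a * b) = F a * b)"

definition frobenius_hom :: "'a::{ring, monoid_mult} set \<Rightarrow> ('a \<Rightarrow> 'a) \<Rightarrow> bool" where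
  "frobenius_hom B E \<longleftrightarrow>
     bimodule_hom B E \<and>
     (\<exists>(n::nat) x y. \<forall>a. a = (\<Sum>i<n. E (a * x i) * y i) \<and> a = (\<Sum>i<n. x i * E (y i * a)))"

definition frobenius_extension :: "'a::{ring, monoid_mult} set \<Rightarrow> bool" where
  "frobenius_extension B \<longleftrightarrow> (\<exists>E. frobenius_hom B E)"

definition uniquely_split :: "'a::{ring, monoid_mult} set \<Rightarrow> bool" where
  "uniquely_split B \<longleftrightarrow> (\<exists>!F. bimodule_hom B F \<and> F 1 = 1)"

end

theory Submission
  imports Defs
begin

text \<open>
  The pairing \<open>(a, c) \<mapsto> E (a * c)\<close> given by a Frobenius homomorphism is nondegenerate, because the
  dual bases recover \<open>a\<close> from the values \<open>E (a * x i)\<close>. The dual bases also show that every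
  \<open>B\<close>-\<open>B\<close>-bimodule homomorphism \<open>F\<close> into \<open>B\<close> is a translate \<open>F a = E (d * a)\<close> of \<open>E\<close>, and
  nondegeneracy turns left \<open>B\<close>-linearity of \<open>F\<close> into the condition that \<open>d\<close> centralizes \<open>B\<close>. So
  the homomorphisms are parametrized by the centralizer, and the projections by the
  \<open>d\<close> in the centralizer with \<open>E d = 1\<close>.

  If \<open>E 1 = 1\<close>, then \<open>E\<close> is a projection, with parameter \<open>1\<close>. When the centralizer is contained in
  \<open>B\<close>, the condition \<open>E d = 1\<close> reads \<open>d = 1\<close>, and \<open>E\<close> is the only projection. Conversely, for \<open>d\<close> in
  the centralizer the element \<open>1 + (d - E d)\<close> is again the parameter of a projection; uniqueness
  forces \<open>d = E d\<close>, which lies in \<open>B\<close>.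
\<close>

lemma bimodule_homD:
  assumes "bimodule_hom B F"
  shows "F a \<in> B" and "additive F"
    and "b \<in> B \<Longrightarrow> F (b * a) = b * F a" and "b \<in> B \<Longrightarrow> F (a * b) = F a * b"
  using assms unfolding bimodule_hom_def by auto

lemma frobenius_hom_bimodule_hom: "frobenius_hom B E \<Longrightarrow> bimodule_hom B E"
  unfolding frobenius_hom_def by simp

text \<open>
  Two elements that define the same functional \<open>a \<mapsto> E (c * a)\<close> have the same expansion
  \<open>c = (\<Sum>i. E (c * x i) * y i)\<close>.
\<close>

lemma frobenius_hom_nondegenerate:
  assumes "frobenius_hom B E" and eq: "\<And>a. E (c * a) = E (d * a)"
  shows "c = d"
proof -
  obtain n :: nat and x y where base: "\<And>a. a = (\<Sum>i<n. E (a * x i) * y i)"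
    using assms(1) unfolding frobenius_hom_def by blast
  have "c = (\<Sum>i<n. E (c * x i) * y i)" by (rule base)
  also have "\<dots> = (\<Sum>i<n. E (d * x i) * y i)" by (simp add: eq)
  also have "\<dots> = d" by (rule base[symmetric])
  finally show ?thesis .
qed

text \<open>
  Applying \<open>F\<close> to \<open>a = (\<Sum>i. x i * E (y i * a))\<close> moves the coefficients \<open>E (y i * a)\<close> out of
  \<open>F\<close> on the right, after which the coefficients \<open>F (x i)\<close> can be moved into \<open>E\<close> on the left.
\<close>

lemma bimodule_hom_eq_frobenius_translate:
  assumes E: "frobenius_hom B E" and F: "bimodule_hom B F"
  obtains d where "d \<in> centralizer B" and "\<And>a. F a = E (d * a)"
proof -
  obtain n :: nat and x y where base: "\<And>a. a = (\<Sum>i<n. x i * E (y i * a))"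
    using E unfolding frobenius_hom_def by blast
  note E_hom = bimodule_homD[OF frobenius_hom_bimodule_hom[OF E]]
  note F_hom = bimodule_homD[OF F]
  define d where "d = (\<Sum>i<n. F (x i) * y i)"
  have F_eq: "F a = E (d * a)" for a
  proof -
    have "F a = F (\<Sum>i<n. x i * E (y i * a))" by (rule arg_cong[OF base])
    also have "\<dots> = (\<Sum>i<n. F (x i) * E (y i * a))"
      by (simp add: additive.sum[OF F_hom(2)] F_hom(4) E_hom(1))
    also have "\<dots> = (\<Sum>i<n. E (F (x i) * y i * a))"
      by (simp add: E_hom(3) F_hom(1) mult.assoc)
    also have "\<dots> = E (d * a)"
      by (simp add: d_def sum_distrib_right additive.sum[OF E_hom(2)])
    finally show ?thesis .
  qed
  have "d * b = b * d" if "b \<in> B" for b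
  proof (rule frobenius_hom_nondegenerate[OF E])
    fix a
    have "E (d * b * a) = F (b * a)" by (simp add: F_eq mult.assoc)
    also have "\<dots> = b * E (d * a)"
      using that by (simp only: F_hom(3) F_eq[of a])
    also have "\<dots> = E (b * d * a)"
      using that by (simp add: E_hom(3) mult.assoc)
    finally show "E (d * b * a) = E (b * d * a)" .
  qed
  then have "d \<in> centralizer B" by (simp add: centralizer_def)
  with F_eq show thesis using that by blast
qed

lemma bimodule_hom_translate:
  assumes F: "bimodule_hom B F" and d: "d \<in> centralizer B"
  shows "bimodule_hom B (\<lambda>a. F (d * a))"
proof -
  note F_hom = bimodule_homD[OF F]
  have "F (d * (b * a)) = b * F (d * a)" if "b \<in> B" for a b
  proof -
    have "d * (b * a) = b * (d * a)"
      using d that by (simp add: centralizer_def flip: mult.assoc)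
    then show ?thesis using that by (simp add: F_hom(3))
  qed
  moreover have "F (d * (a * b)) = F (d * a) * b" if "b \<in> B" for a b
    using F_hom(4)[OF that, of "d * a"] by (simp add: mult.assoc)
  moreover have "additive (\<lambda>a. F (d * a))"
    by (simp add: additive_def distrib_left additive.add[OF F_hom(2)])
  ultimately show ?thesis using F_hom(1) by (auto simp: bimodule_hom_def)
qed

lemma bimodule_hom_preserves_centralizer:
  assumes "bimodule_hom B F" and "d \<in> centralizer B"
  shows "F d \<in> centralizer B"
proof -
  have "F d * b = b * F d" if "b \<in> B" for b
  proof -
    have "F d * b = F (d * b)" using bimodule_homD(4)[OF assms(1) that] by simp
    also have "d * b = b * d" using assms(2) that by (simp add: centralizer_def)
    also have "F (b * d) = b * F d" by (rule bimodule_homD(3)[OF assms(1) that])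
    finally show ?thesis .
  qed
  then show ?thesis by (simp add: centralizer_def)
qed

lemma center_eq_Int_centralizer: "center B = B \<inter> centralizer B"
  by (auto simp: center_def centralizer_def)

theorem theorem3p4:
  fixes scale :: "'k::field \<Rightarrow> 'a::{ring, monoid_mult} \<Rightarrow> 'a"
    and B :: "'a set" and E :: "'a \<Rightarrow> 'a"
  assumes "unital_algebra scale"
    and "subalgebra scale B"
    and "frobenius_extension B"
    and "frobenius_hom B E"
    and "E 1 = 1"
  shows "uniquely_split B \<longleftrightarrow> centralizer B = center B"
proof -
  have E: "bimodule_hom B E" using assms(4) by (rule frobenius_hom_bimodule_hom)
  note E_hom = bimodule_homD[OF E]
  have E_id: "E b = b" if "b \<in> B" for b
    using E_hom(3)[OF that, of 1] assms(5) by simp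
  show ?thesis
  proof
    assume "uniquely_split B"
    then have unique: "F = G"
      if "bimodule_hom B F \<and> F 1 = 1" and "bimodule_hom B G \<and> G 1 = 1" for F G
      using that unfolding uniquely_split_def by blast
    have "d \<in> B" if d: "d \<in> centralizer B" for d
    proof -
      \<comment> \<open>Subtracting \<open>E d\<close> moves \<open>d\<close> into the kernel of the idempotent \<open>E\<close>, so that adding the result
        to the parameter \<open>1\<close> of \<open>E\<close> keeps the value at \<open>1\<close>.\<close>
      define e where "e = 1 + (d - E d)"
      have e: "e \<in> centralizer B"
        using d bimodule_hom_preserves_centralizer[OF E d]
        by (simp add: e_def centralizer_def algebra_simps)
      have "E e = 1"
        by (simp add: e_def additive.add[OF E_hom(2)] additive.diff[OF E_hom(2)]
            E_id E_hom(1) assms(5))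
      then have "bimodule_hom B (\<lambda>a. E (e * a)) \<and> E (e * 1) = 1"
        using bimodule_hom_translate[OF E e] by simp
      then have "(\<lambda>a. E (e * a)) = E"
        by (rule unique) (simp add: E assms(5))
      then have "E (e * a) = E (1 * a)" for a by (simp add: fun_eq_iff)
      then have "e = 1" by (rule frobenius_hom_nondegenerate[OF assms(4)])
      then have "E d = d" by (simp add: e_def)
      with E_hom(1)[of d] show ?thesis by simp
    qed
    then show "centralizer B = center B" by (auto simp: center_eq_Int_centralizer)
  next
    assume central: "centralizer B = center B"
    have "F = E" if F: "bimodule_hom B F" and "F 1 = 1" for F
    proof -
      obtain d where d: "d \<in> centralizer B" and F_eq: "\<And>a. F a = E (d * a)"
        using bimodule_hom_eq_frobenius_translate[OF assms(4) F] by blast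
      have "d \<in> B" using d central by (simp add: center_def)
      then have "d = 1" using F_eq[of 1] \<open>F 1 = 1\<close> by (simp add: E_id)
      then show ?thesis using F_eq by (simp add: fun_eq_iff)
    qed
    then show "uniquely_split B"
      unfolding uniquely_split_def using E assms(5) by blast
  qed
qed

end
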